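(* Let $\varphi, \psi$ be unimodular functions in $L^\infty(\mathbb{T})$ such that $\ker(T_{\varphi \overline{\psi}})=\ker(T_{\overline{\varphi} \psi})=\{ 0 \}$. Then $$\|M_\theta P_+-P_+M_\theta\|\ge \cos^{-1}(\gamma(T_{\varphi\overline{\psi}}))$$ for every real argument $\theta \in L^\infty$ of the function $\varphi \overline{\psi}$, i.e. for every real-valued $\theta\in L^\infty(\mathbb{T})$ with $e^{i\theta}=\varphi\overline{\psi}$ a.e.
   Context: $L^2=L^2(\mathbb{T})$ on the unit circle $\mathbb{T}$; $H^2\subset L^2$ is the Hardy space and $P_+$ is the orthogonal projection of $L^2$ onto $H^2$. For $\varphi\in L^\infty$, $M_\varphi\in\mathcal{B}(L^2)$ is multiplication by $\varphi$, and $T_\varphi:H^2\to H^2$, $T_\varphi f=P_+(\varphi f)$, is the Toeplitz operator. Unimodular means $|\varphi|=1$ a.e. The reduced minimum modulus of an operator $A\ne 0$ is $\gamma(A)=\inf\{\|Af\| : \|f\|=1,\ f\in\ker(A)^\perp\}=\inf\,(\sigma(|A|)\setminus\{0\})$, where $\sigma$ denotes the spectrum. $\|\cdot\|$ is the operator norm and $\cos^{-1}:[0,1]\to[0,\pi/2]$. *)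

theory Defs
  imports "HOL-Analysis.Analysis"
begin

text \<open>Normalized arc length on the unit circle, as a Borel measure whose space is the circle.\<close>

definition circle_measure :: "complex measure" where
  "circle_measure =
     distr (uniform_measure lborel {0..2 * pi}) (restrict_space borel (sphere 0 1)) cis"

definition square_integrable :: "(complex \<Rightarrow> complex) \<Rightarrow> bool" where
  "square_integrable f \<longleftrightarrow>
     f \<in> borel_measurable circle_measure \<and> integrable circle_measure (\<lambda>z. (cmod (f z))\<^sup>2)"

text \<open>Elements of \<open>Linf\<close> are representatives, not almost-everywhere classes; everything below
  depends on them only up to equality almost everywhere.\<close>

definition Linf :: "(complex \<Rightarrow> 'a::real_normed_vector) set" where
  "Linf = {f \<in> borel_measurable circle_measure.
             \<exists>C. AE z in circle_measure. norm (f z) \<le> C}"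

definition unimodular :: "(complex \<Rightarrow> complex) \<Rightarrow> bool" where
  "unimodular f \<longleftrightarrow> (AE z in circle_measure. cmod (f z) = 1)"


lemma square_integrable_zero: "square_integrable (\<lambda>z. 0)"
  by (simp add: square_integrable_def)

lemma square_integrable_add:
  assumes "square_integrable f" "square_integrable g"
  shows "square_integrable (\<lambda>z. f z + g z)"
  unfolding square_integrable_def
proof
  have [measurable]: "f \<in> borel_measurable circle_measure" "g \<in> borel_measurable circle_measure"
    using assms by (auto simp: square_integrable_def)
  show "(\<lambda>z. f z + g z) \<in> borel_measurable circle_measure" by measurable
  have "integrable circle_measure (\<lambda>z. 2 * (cmod (f z))\<^sup>2 + 2 * (cmod (g z))\<^sup>2)"
    using assms by (auto simp: square_integrable_def)
  then show "integrable circle_measure (\<lambda>z. (cmod (f z + g z))\<^sup>2)"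
  proof (rule Bochner_Integration.integrable_bound)
    show "AE z in circle_measure. norm ((cmod (f z + g z))\<^sup>2)
            \<le> norm (2 * (cmod (f z))\<^sup>2 + 2 * (cmod (g z))\<^sup>2)"
    proof (rule AE_I2)
      fix z
      have "(cmod (f z + g z))\<^sup>2 \<le> (cmod (f z) + cmod (g z))\<^sup>2"
        by (simp add: norm_triangle_ineq power_mono)
      also have "\<dots> \<le> 2 * (cmod (f z))\<^sup>2 + 2 * (cmod (g z))\<^sup>2"
        using zero_le_power2[of "cmod (f z) - cmod (g z)"]
        by (simp add: power2_sum power2_diff)
      finally show "norm ((cmod (f z + g z))\<^sup>2) \<le> norm (2 * (cmod (f z))\<^sup>2 + 2 * (cmod (g z))\<^sup>2)"
        by simp
    qed
  qed measurable
qed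

lemma square_integrable_mult:
  assumes "\<phi> \<in> Linf" "square_integrable f"
  shows "square_integrable (\<lambda>z. \<phi> z * f z)"
  unfolding square_integrable_def
proof
  have [measurable]: "f \<in> borel_measurable circle_measure" "\<phi> \<in> borel_measurable circle_measure"
    using assms by (auto simp: square_integrable_def Linf_def)
  show "(\<lambda>z. \<phi> z * f z) \<in> borel_measurable circle_measure" by measurable
  obtain C where C: "AE z in circle_measure. cmod (\<phi> z) \<le> C"
    using assms by (auto simp: Linf_def)
  have "integrable circle_measure (\<lambda>z. C\<^sup>2 * (cmod (f z))\<^sup>2)"
    using assms by (auto simp: square_integrable_def)
  then show "integrable circle_measure (\<lambda>z. (cmod (\<phi> z * f z))\<^sup>2)"
  proof (rule Bochner_Integration.integrable_bound)
    show "AE z in circle_measure. norm ((cmod (\<phi> z * f z))\<^sup>2) \<le> norm (C\<^sup>2 * (cmod (f z))\<^sup>2)"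
      using C
    proof eventually_elim
      case (elim z)
      then have "(cmod (\<phi> z))\<^sup>2 \<le> C\<^sup>2" by (simp add: power_mono)
      then show ?case by (simp add: norm_mult power_mult_distrib mult_right_mono)
    qed
  qed measurable
qed

lemma const_in_Linf: "(\<lambda>z. c) \<in> Linf"
  by (auto simp: Linf_def)

lemma square_integrable_cmult: "square_integrable f \<Longrightarrow> square_integrable (\<lambda>z. c * f z)"
  using square_integrable_mult[OF const_in_Linf] by simp

lemma integrable_mult_cnj:
  assumes "square_integrable f" "square_integrable g"
  shows "integrable circle_measure (\<lambda>z. f z * cnj (g z))"
proof -
  have [measurable]: "f \<in> borel_measurable circle_measure" "g \<in> borel_measurable circle_measure"
    using assms by (auto simp: square_integrable_def)
  have [measurable]: "(\<lambda>z. cnj (g z)) \<in> borel_measurable circle_measure"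
    by (rule borel_measurable_continuous_on[OF continuous_on_cnj[OF continuous_on_id]]) measurable
  have "integrable circle_measure (\<lambda>z. (cmod (f z))\<^sup>2 + (cmod (g z))\<^sup>2)"
    using assms by (auto simp: square_integrable_def)
  then show ?thesis
  proof (rule Bochner_Integration.integrable_bound)
    show "AE z in circle_measure. norm (f z * cnj (g z)) \<le> norm ((cmod (f z))\<^sup>2 + (cmod (g z))\<^sup>2)"
    proof (rule AE_I2)
      fix z
      have "0 \<le> cmod (f z) * cmod (g z)" by simp
      then show "norm (f z * cnj (g z)) \<le> norm ((cmod (f z))\<^sup>2 + (cmod (g z))\<^sup>2)"
        using zero_le_power2[of "cmod (f z) - cmod (g z)"]
        unfolding norm_mult complex_mod_cnj power2_diff real_norm_def by linarith
    qed
  qed measurable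
qed


definition ae_equal :: "(complex \<Rightarrow> complex) \<Rightarrow> (complex \<Rightarrow> complex) \<Rightarrow> bool" where
  "ae_equal f g \<longleftrightarrow> square_integrable f \<and> square_integrable g \<and>
     (AE z in circle_measure. f z = g z)"

quotient_type l2_circle = "complex \<Rightarrow> complex" / partial: ae_equal
proof (rule part_equivpI)
  show "\<exists>f. ae_equal f f"
    using square_integrable_zero by (auto simp: ae_equal_def)
  show "symp ae_equal"
    by (rule sympI) (auto simp: ae_equal_def elim: eventually_mono)
  show "transp ae_equal"
    by (rule transpI) (auto simp: ae_equal_def elim: eventually_elim2)
qed

lift_definition cinner :: "l2_circle \<Rightarrow> l2_circle \<Rightarrow> complex" is
  "\<lambda>f g. \<integral>z. f z * cnj (g z) \<partial>circle_measure"
proof -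
  fix f f' g g' :: "complex \<Rightarrow> complex"
  assume A: "ae_equal f f'" "ae_equal g g'"
  then have "integrable circle_measure (\<lambda>z. f z * cnj (g z))"
    "integrable circle_measure (\<lambda>z. f' z * cnj (g' z))"
    by (auto simp: ae_equal_def intro: integrable_mult_cnj)
  moreover have "AE z in circle_measure. f z * cnj (g z) = f' z * cnj (g' z)"
    using A unfolding ae_equal_def by (auto elim: eventually_elim2)
  ultimately show "(\<integral>z. f z * cnj (g z) \<partial>circle_measure) = (\<integral>z. f' z * cnj (g' z) \<partial>circle_measure)"
    by (intro integral_cong_AE) auto
qed

text \<open>The library has no class of complex inner product spaces; \<open>L\<^sup>2\<close> is made an instance of
  \<open>real_inner\<close> with the real part of \<open>cinner\<close>, which induces the usual norm.\<close>

instantiation l2_circle :: real_inner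
begin

lift_definition zero_l2_circle :: l2_circle is "\<lambda>z. 0"
  by (simp add: ae_equal_def square_integrable_zero)

lift_definition plus_l2_circle :: "l2_circle \<Rightarrow> l2_circle \<Rightarrow> l2_circle" is "\<lambda>f g z. f z + g z"
  by (auto simp: ae_equal_def square_integrable_add elim: eventually_elim2)

lift_definition uminus_l2_circle :: "l2_circle \<Rightarrow> l2_circle" is "\<lambda>f z. - f z"
  by (auto simp: ae_equal_def square_integrable_def elim: eventually_mono)

definition minus_l2_circle :: "l2_circle \<Rightarrow> l2_circle \<Rightarrow> l2_circle" where
  "minus_l2_circle f g = f + - g"

lift_definition scaleR_l2_circle :: "real \<Rightarrow> l2_circle \<Rightarrow> l2_circle" is
  "\<lambda>r f z. complex_of_real r * f z"
  by (auto simp: ae_equal_def square_integrable_cmult elim: eventually_mono)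

definition inner_l2_circle :: "l2_circle \<Rightarrow> l2_circle \<Rightarrow> real" where
  "inner_l2_circle f g = Re (cinner f g)"

definition norm_l2_circle :: "l2_circle \<Rightarrow> real" where
  "norm_l2_circle f = sqrt (inner f f)"

definition dist_l2_circle :: "l2_circle \<Rightarrow> l2_circle \<Rightarrow> real" where
  "dist_l2_circle f g = norm (f - g)"

definition sgn_l2_circle :: "l2_circle \<Rightarrow> l2_circle" where
  "sgn_l2_circle f = inverse (norm f) *\<^sub>R f"

definition uniformity_l2_circle :: "(l2_circle \<times> l2_circle) filter" where
  "uniformity_l2_circle = (INF e\<in>{0<..}. principal {(f, g). dist f g < e})"

definition open_l2_circle :: "l2_circle set \<Rightarrow> bool" where
  "open_l2_circle U \<longleftrightarrow> (\<forall>f\<in>U. \<forall>\<^sub>F (f', g) in uniformity. f' = f \<longrightarrow> g \<in> U)"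

instance
proof
  fix f g h :: l2_circle and a b r :: real and U :: "l2_circle set"
  show "f + g + h = f + (g + h)"
    by transfer (auto simp: ae_equal_def add.assoc intro!: square_integrable_add)
  show "f + g = g + f"
    by transfer (auto simp: ae_equal_def add.commute intro!: square_integrable_add)
  show "0 + f = f"
    by transfer (auto simp: ae_equal_def)
  show "- f + f = 0"
    by transfer (auto simp: ae_equal_def square_integrable_zero)
  show "f - g = f + - g"
    by (rule minus_l2_circle_def)
  show "a *\<^sub>R (f + g) = a *\<^sub>R f + a *\<^sub>R g"
    by transfer (auto simp: ae_equal_def distrib_left distrib_right
        intro!: square_integrable_add square_integrable_cmult)
  show "(a + b) *\<^sub>R f = a *\<^sub>R f + b *\<^sub>R f"
    by transfer (auto simp: ae_equal_def distrib_left distrib_right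
        intro!: square_integrable_add square_integrable_cmult)
  show "a *\<^sub>R b *\<^sub>R f = (a * b) *\<^sub>R f"
    by transfer (auto simp: ae_equal_def mult.assoc intro!: square_integrable_cmult)
  show "1 *\<^sub>R f = f"
    by transfer (auto simp: ae_equal_def)
  show "dist f g = norm (f - g)"
    by (rule dist_l2_circle_def)
  show "sgn f = inverse (norm f) *\<^sub>R f"
    by (rule sgn_l2_circle_def)
  show "uniformity = (INF e\<in>{0<..}. principal {(f, g :: l2_circle). dist f g < e})"
    by (rule uniformity_l2_circle_def)
  show "open U \<longleftrightarrow> (\<forall>f\<in>U. \<forall>\<^sub>F (f', g) in uniformity. f' = f \<longrightarrow> g \<in> U)"
    by (rule open_l2_circle_def)
  have "cinner f g = cnj (cinner g f)"
    by transfer (subst Bochner_Integration.integral_cnj[symmetric], simp add: mult.commute)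
  then show "inner f g = inner g f"
    by (simp add: inner_l2_circle_def)
  have "cinner (f + g) h = cinner f h + cinner g h"
    by transfer (auto simp: ae_equal_def distrib_right integrable_mult_cnj)
  then show "inner (f + g) h = inner f h + inner g h"
    by (simp add: inner_l2_circle_def)
  have "cinner (r *\<^sub>R f) g = complex_of_real r * cinner f g"
    by transfer (simp add: mult.assoc)
  then show "inner (r *\<^sub>R f) g = r * inner f g"
    by (simp add: inner_l2_circle_def)
  have norm: "(\<integral>z. F z * cnj (F z) \<partial>circle_measure)
      = complex_of_real (\<integral>z. (cmod (F z))\<^sup>2 \<partial>circle_measure)" for F
    by (simp only: complex_norm_square[symmetric] integral_complex_of_real)
  have "0 \<le> Re (cinner f f)"
    by transfer (simp add: norm)
  then show "0 \<le> inner f f"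
    by (simp add: inner_l2_circle_def)
  have "Re (cinner f f) = 0 \<longleftrightarrow> f = 0"
    by transfer
      (auto simp: norm ae_equal_def square_integrable_def integral_nonneg_eq_0_iff_AE)
  then show "inner f f = 0 \<longleftrightarrow> f = 0"
    by (simp add: inner_l2_circle_def)
  show "norm f = sqrt (inner f f)"
    by (rule norm_l2_circle_def)
qed

end


lemma space_circle_measure: "space circle_measure = sphere 0 1"
  by (simp add: circle_measure_def space_restrict_space)

lemma cis_measurable:
  "cis \<in> uniform_measure lborel {0..2 * pi} \<rightarrow>\<^sub>M restrict_space borel (sphere 0 1)"
proof (rule measurable_restrict_space2)
  have "cis \<in> borel_measurable borel"
    by (intro borel_measurable_continuous_onI continuous_intros)
  then show "cis \<in> borel_measurable (uniform_measure lborel {0..2 * pi})"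
    by (simp cong: measurable_cong_sets)
qed auto

lemma emeasure_circle_measure: "emeasure circle_measure (space circle_measure) = 1"
proof -
  have "emeasure circle_measure (space circle_measure)
      = emeasure (uniform_measure lborel {0..2 * pi}) UNIV"
    unfolding circle_measure_def
    using emeasure_distr[OF cis_measurable sets.top]
    by (simp add: space_restrict_space vimage_def)
  also have "\<dots> = 1"
    by (subst emeasure_uniform_measure) (auto simp: ennreal_divide_self)
  finally show ?thesis .
qed

lift_definition monomial :: "int \<Rightarrow> l2_circle" is "\<lambda>n z. z powi n"
proof -
  fix n :: int
  have "continuous_on (sphere 0 1) (\<lambda>z :: complex. z powi n)"
    by (auto intro!: continuous_intros)
  then have "(\<lambda>z :: complex. z powi n) \<in> borel_measurable circle_measure"
    unfolding circle_measure_def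
    by (simp add: borel_measurable_continuous_on_restrict)
  moreover have "integrable circle_measure (\<lambda>z. (cmod (z powi n))\<^sup>2)"
  proof -
    have "integrable circle_measure (\<lambda>z. 1 :: real)"
      by (intro finite_measure.integrable_const finite_measureI)
        (simp add: emeasure_circle_measure)
    moreover have "integrable circle_measure (\<lambda>z. (cmod (z powi n))\<^sup>2)
        = integrable circle_measure (\<lambda>z. 1 :: real)"
      by (rule Bochner_Integration.integrable_cong)
        (auto simp: space_circle_measure norm_power_int)
    ultimately show ?thesis by simp
  qed
  ultimately show "ae_equal (\<lambda>z. z powi n) (\<lambda>z. z powi n)"
    by (simp add: ae_equal_def square_integrable_def)
qed

text \<open>The \<open>n\<close>-th Fourier coefficient: on the circle \<open>cnj (z powi n) = z powi (-n)\<close>.\<close>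

definition fourier_coeff :: "l2_circle \<Rightarrow> int \<Rightarrow> complex" where
  "fourier_coeff f n = cinner f (monomial n)"

definition H2 :: "l2_circle set" where
  "H2 = {f. \<forall>n<0. fourier_coeff f n = 0}"

text \<open>Existence and uniqueness of the described \<open>g\<close> follow from the projection theorem, since
  \<open>H2\<close> is a closed subspace of the Hilbert space \<open>L\<^sup>2\<close> (completeness is not proved here).\<close>

definition P_plus :: "l2_circle \<Rightarrow> l2_circle" where
  "P_plus f = (THE g. g \<in> H2 \<and> (\<forall>h\<in>H2. cinner (f - g) h = 0))"

text \<open>Multiplication is only meaningful for symbols in \<open>Linf\<close>; the zero operator is a junk value
  for all others.\<close>

lift_definition mult_op :: "(complex \<Rightarrow> complex) \<Rightarrow> l2_circle \<Rightarrow> l2_circle" is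
  "\<lambda>\<phi> f. if \<phi> \<in> Linf then (\<lambda>z. \<phi> z * f z) else (\<lambda>z. 0)"
  by (auto simp: ae_equal_def square_integrable_zero intro: square_integrable_mult
      elim: eventually_mono)

text \<open>The Toeplitz operator is an operator on \<open>H2\<close>; as a HOL function it is total on \<open>L\<^sup>2\<close>, so its
  domain \<open>H2\<close> is passed explicitly to \<open>kernel_on\<close> and \<open>reduced_min_modulus\<close>.\<close>

definition toeplitz :: "(complex \<Rightarrow> complex) \<Rightarrow> l2_circle \<Rightarrow> l2_circle" where
  "toeplitz \<phi> f = P_plus (mult_op \<phi> f)"

definition kernel_on :: "l2_circle set \<Rightarrow> (l2_circle \<Rightarrow> l2_circle) \<Rightarrow> l2_circle set" where
  "kernel_on H A = {f \<in> H. A f = 0}"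

text \<open>As usual, this is only meaningful for \<open>A\<close> nonzero on \<open>H\<close> (otherwise it is \<open>Inf {}\<close>).\<close>

definition reduced_min_modulus :: "l2_circle set \<Rightarrow> (l2_circle \<Rightarrow> l2_circle) \<Rightarrow> real" where
  "reduced_min_modulus H A =
     Inf {norm (A f) | f. f \<in> H \<and> norm f = 1 \<and> (\<forall>g\<in>kernel_on H A. cinner f g = 0)}"

end

(* Fix a unit vector f in H2, put v t = exp(i t theta) f and let alpha t be the angle between v t
   and H2, so that cos (alpha t) = norm (P (v t)).  The part of the derivative i theta (v t) that can
   change the angle is the off-diagonal block (1 - P) theta P of the commutator [theta, P]; hence
   alpha grows at rate at most the norm c of the commutator.  As alpha 0 = 0, this gives
   norm (T f) = cos (alpha 1) with alpha 1 <= c for T the Toeplitz operator of exp(i theta), and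
   taking the infimum over f gives the claim.  To avoid the singularities of the angle function, the
   argument is run with D = cos (2 alpha) = 2 norm (P v)^2 - 1, which satisfies
   |D'| <= 2 c sqrt (1 - D^2).  The projection P exists because L2 is complete: an L2-Cauchy sequence
   has an almost everywhere convergent subsequence, and Fatou's lemma identifies its limit. *)

theory Submission
  imports Defs
begin

subsection \<open>Projections and growth of angles\<close>

text \<open>A sequence in \<open>S\<close> minimising the distance to \<open>f\<close> is Cauchy by
  the parallelogram law, so completeness yields a nearest point \<open>g\<close>. Moving
  \<open>g\<close> along a direction \<open>h\<close> in \<open>S\<close> cannot reduce the
  distance, which forces \<open>f - g\<close> to be orthogonal to \<open>h\<close>.\<close>

lemma orthogonal_projection_exists:
  fixes S :: "'a::{real_inner, complete_space} set"
  assumes S: "subspace S" "closed S"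
  obtains g where "g \<in> S" "\<And>h. h \<in> S \<Longrightarrow> inner (f - g) h = 0"
proof -
  define d where "d = infdist f S"
  have ne: "S \<noteq> {}" using subspace_0[OF S(1)] by auto
  have d_le: "d \<le> norm (f - y)" if "y \<in> S" for y
    using infdist_le[OF that, of f] by (simp add: d_def dist_norm)
  have d0: "0 \<le> d" by (simp add: d_def infdist_nonneg)
  have "\<exists>y\<in>S. norm (f - y) < d + inverse (real (Suc n))" for n
  proof (rule ccontr)
    assume "\<not> ?thesis"
    then have "d + inverse (real (Suc n)) \<le> infdist f S"
      unfolding infdist_notempty[OF ne] by (intro cINF_greatest ne) (auto simp: dist_norm not_less)
    then show False by (simp add: d_def)
  qed
  then obtain y where y: "\<And>n. y n \<in> S" "\<And>n. norm (f - y n) < d + inverse (real (Suc n))"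
    by metis
  \<comment> \<open>Expanding the square of \<open>d + e\<close> and estimating the square of
    \<open>e\<close> by \<open>e\<close> itself gives the factor \<open>2 * d + 1\<close>; the
    excess over the square of \<open>d\<close> is then linear in \<open>e\<close>.\<close>
  have sq: "(norm (f - y n))\<^sup>2 \<le> d\<^sup>2 + (2 * d + 1) * inverse (real (Suc n))" for n
  proof -
    define e where "e = inverse (real (Suc n))"
    have e: "0 \<le> e" "e \<le> 1" by (auto simp: e_def field_simps)
    have "(norm (f - y n))\<^sup>2 \<le> (d + e)\<^sup>2"
      using y(2)[of n] by (intro power_mono) (auto simp: e_def)
    also have "\<dots> \<le> d\<^sup>2 + (2 * d + 1) * e"
      using e mult_left_mono[of e 1 e] by (simp add: power2_eq_square algebra_simps)
    finally show ?thesis by (simp add: e_def)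
  qed
  have par: "(norm (y m - y n))\<^sup>2 \<le> 2 * (2 * d + 1) * (inverse (real (Suc m)) + inverse (real (Suc n)))" for m n
  proof -
    \<comment> \<open>The midpoint lies in \<open>S\<close>, hence is at distance at least
      \<open>d\<close> from \<open>f\<close>. In the parallelogram identity the squares of
      \<open>d\<close> therefore cancel and only the two excesses remain.\<close>
    have mid: "(1/2) *\<^sub>R (y m + y n) \<in> S"
      using y(1) S(1) by (intro subspace_scale subspace_add) auto
    have "d\<^sup>2 \<le> (norm (f - (1/2) *\<^sub>R (y m + y n)))\<^sup>2"
      using d_le[OF mid] d0 by (intro power_mono)
    moreover have "(norm (y m - y n))\<^sup>2
        = 2 * (norm (f - y m))\<^sup>2 + 2 * (norm (f - y n))\<^sup>2 - 4 * (norm (f - (1/2) *\<^sub>R (y m + y n)))\<^sup>2"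
      unfolding power2_norm_eq_inner
      by (simp add: inner_diff_left inner_diff_right inner_add_left inner_add_right inner_commute
          algebra_simps)
    ultimately show ?thesis
      using sq[of m] sq[of n] by (simp add: algebra_simps)
  qed
  have "Cauchy y"
  proof (rule metric_CauchyI)
    fix e :: real assume e: "e > 0"
    have "(\<lambda>n. 4 * (2 * d + 1) * inverse (real (Suc n))) \<longlonglongrightarrow> 4 * (2 * d + 1) * 0"
      by (intro tendsto_intros LIMSEQ_inverse_real_of_nat)
    then have "\<forall>\<^sub>F n in sequentially. 4 * (2 * d + 1) * inverse (real (Suc n)) < e\<^sup>2"
      by (rule order_tendstoD) (use e in auto)
    then obtain N where N: "4 * (2 * d + 1) * inverse (real (Suc N)) < e\<^sup>2"
      by (auto simp: eventually_sequentially)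
    show "\<exists>M. \<forall>m\<ge>M. \<forall>n\<ge>M. dist (y m) (y n) < e"
    proof (intro exI allI impI)
      fix m n assume mn: "m \<ge> N" "n \<ge> N"
      have "inverse (real (Suc m)) \<le> inverse (real (Suc N))"
        "inverse (real (Suc n)) \<le> inverse (real (Suc N))"
        using mn by (auto intro!: le_imp_inverse_le)
      then have "inverse (real (Suc m)) + inverse (real (Suc n)) \<le> 2 * inverse (real (Suc N))"
        by linarith
      then have "2 * (2 * d + 1) * (inverse (real (Suc m)) + inverse (real (Suc n)))
          \<le> 2 * (2 * d + 1) * (2 * inverse (real (Suc N)))"
        using d0 by (intro mult_left_mono) auto
      also have "\<dots> = 4 * (2 * d + 1) * inverse (real (Suc N))" by simp
      also note N
      finally have "(norm (y m - y n))\<^sup>2 < e\<^sup>2" using par[of m n] by (rule le_less_trans[rotated])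
      then show "dist (y m) (y n) < e"
        using e by (simp add: dist_norm power_less_imp_less_base)
    qed
  qed
  then obtain g where g: "y \<longlonglongrightarrow> g" by (auto simp: Cauchy_convergent_iff convergent_def)
  have gS: "g \<in> S" using closed_sequentially[OF S(2)] y(1) g by blast
  have "norm (f - g) \<le> d"
  proof (rule LIMSEQ_le)
    show "(\<lambda>n. norm (f - y n)) \<longlonglongrightarrow> norm (f - g)" using g by (intro tendsto_intros)
    have "(\<lambda>n. d + inverse (real (Suc n))) \<longlonglongrightarrow> d + 0"
      by (intro tendsto_intros LIMSEQ_inverse_real_of_nat)
    then show "(\<lambda>n. d + inverse (real (Suc n))) \<longlonglongrightarrow> d" by simp
    show "\<exists>N. \<forall>n\<ge>N. norm (f - y n) \<le> d + inverse (real (Suc n))"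
      using y(2) less_imp_le by blast
  qed
  then have min: "norm (f - g) \<le> norm (f - h)" if "h \<in> S" for h
    using d_le[OF that] by simp
  have "inner (f - g) h = 0" if h: "h \<in> S" for h
  proof (cases "h = 0")
    case False
    \<comment> \<open>This \<open>t\<close> minimises the quadratic
      \<open>norm (f - g - t *\<^sub>R h)\<close> squared; the decrease it achieves is the square of
      \<open>inner (f - g) h\<close> over \<open>inner h h\<close>, which must then vanish.\<close>
    define t where "t = inner (f - g) h / inner h h"
    have "g + t *\<^sub>R h \<in> S" using gS h S(1) by (intro subspace_add subspace_scale)
    then have "(norm (f - g))\<^sup>2 \<le> (norm (f - g - t *\<^sub>R h))\<^sup>2"
      using min[of "g + t *\<^sub>R h"] by (intro power_mono) (auto simp: algebra_simps)
    also have "\<dots> = (norm (f - g))\<^sup>2 - 2 * t * inner (f - g) h + t\<^sup>2 * inner h h"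
      unfolding power2_norm_eq_inner inner_diff_left[of "f - g"] inner_diff_right[of _ "f - g"]
      by (simp add: inner_commute power2_eq_square algebra_simps)
    also have "\<dots> = (norm (f - g))\<^sup>2 - (inner (f - g) h)\<^sup>2 / inner h h"
      using False by (simp add: t_def power2_eq_square)
    finally have "(inner (f - g) h)\<^sup>2 / inner h h \<le> 0" by simp
    moreover have "0 < inner h h" using False by simp
    ultimately have "(inner (f - g) h)\<^sup>2 \<le> 0" by (simp add: divide_le_0_iff)
    then show ?thesis by simp
  qed simp
  with gS show ?thesis by (rule that)
qed

text \<open>The derivative of \<open>arccos\<close> is unbounded at \<open>\<plusminus>1\<close>, so the mean value theorem is applied to
  \<open>arccos (k * D t)\<close> for \<open>k < 1\<close>, which satisfies the same growth bound, before letting \<open>k\<close> tend to 1.\<close>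

lemma arccos_growth:
  fixes D D' :: "real \<Rightarrow> real"
  assumes deriv: "\<And>t. t \<in> {0..1} \<Longrightarrow> (D has_real_derivative D' t) (at t)"
    and range: "\<And>t. t \<in> {0..1} \<Longrightarrow> \<bar>D t\<bar> \<le> 1"
    and growth: "\<And>t. t \<in> {0..1} \<Longrightarrow> \<bar>D' t\<bar> \<le> C * sqrt (1 - (D t)\<^sup>2)"
    and D0: "D 0 = 1" and C_nonneg: "0 \<le> C"
  shows "arccos (D 1) \<le> C"
proof -
  have 1: "arccos (k * D 1) \<le> arccos k + k * C" if k: "0 < k" "k < 1" for k
  proof -
    have kD: "\<bar>k * D t\<bar> < 1" if "t \<in> {0..1}" for t
    proof -
      have "\<bar>k * D t\<bar> \<le> k * 1" unfolding abs_mult using k range[OF that] by (intro mult_mono) auto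
      with k show ?thesis by simp
    qed
    have "\<exists>z::real>0. z < 1 \<and> arccos (k * D 1) - arccos (k * D 0)
        = (1 - 0) * (- (k * D' z) / sqrt (1 - (k * D z)\<^sup>2))"
    proof (rule MVT2)
      fix t :: real assume "0 \<le> t" "t \<le> 1"
      then have t: "t \<in> {0..1}" by simp
      show "((\<lambda>t. arccos (k * D t)) has_real_derivative - (k * D' t) / sqrt (1 - (k * D t)\<^sup>2)) (at t)"
        using kD[OF t] by (auto intro!: derivative_eq_intros deriv[OF t] simp: field_simps)
    qed simp
    then obtain z where z: "0 < z" "z < 1"
      and eq: "arccos (k * D 1) - arccos (k * D 0) = - (k * D' z) / sqrt (1 - (k * D z)\<^sup>2)"
      by auto
    have zI: "z \<in> {0..1}" using z by simp
    have s0: "0 < sqrt (1 - (k * D z)\<^sup>2)"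
      using kD[OF zI] by (simp add: abs_square_less_1)
    have "- (k * D' z) \<le> k * \<bar>D' z\<bar>"
      using k mult_left_mono[of "- D' z" "\<bar>D' z\<bar>" k] by simp
    also have "\<dots> \<le> k * (C * sqrt (1 - (D z)\<^sup>2))"
      using k growth[OF zI] by (intro mult_left_mono) auto
    \<comment> \<open>Scaling by \<open>k\<close> moves \<open>D z\<close> towards 0, so the square
      root can only grow; this is why the growth bound survives the scaling.\<close>
    also have "\<dots> \<le> k * (C * sqrt (1 - (k * D z)\<^sup>2))"
    proof (intro mult_left_mono)
      have "k\<^sup>2 * (D z)\<^sup>2 \<le> 1 * (D z)\<^sup>2"
        using k by (intro mult_right_mono) (auto simp: power_le_one)
      then show "sqrt (1 - (D z)\<^sup>2) \<le> sqrt (1 - (k * D z)\<^sup>2)" by (simp add: power_mult_distrib)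
      show "0 \<le> C" using C_nonneg .
    qed (use k in auto)
    finally have "- (k * D' z) / sqrt (1 - (k * D z)\<^sup>2) \<le> k * C"
      unfolding pos_divide_le_eq[OF s0] by (simp only: mult.assoc)
    then show ?thesis using eq D0 by simp
  qed
  have lim: "((\<lambda>k. k) \<longlongrightarrow> 1) (at_left (1::real))" by (rule tendsto_ident_at)
  have cts: "((\<lambda>k. arccos (k * a)) \<longlongrightarrow> arccos (1 * a)) (at_left 1)" if "\<bar>a\<bar> \<le> 1" for a
  proof -
    \<comment> \<open>Although not differentiable at the ends of [-1, 1], \<open>arccos\<close> is
      continuous there, and \<open>k * a\<close> stays in that interval for \<open>k\<close> in
      [0, 1]. The limit at 1 is therefore taken from the left.\<close>
    have "continuous_on {0..1} (\<lambda>k. arccos (k * a))"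
    proof (intro continuous_intros ballI)
      fix k :: real assume k: "k \<in> {0..1}"
      have "\<bar>k * a\<bar> \<le> 1 * 1" unfolding abs_mult using k that by (intro mult_mono) auto
      then show "-1 \<le> k * a \<and> k * a \<le> 1" by auto
    qed
    from this[unfolded continuous_on, THEN bspec, of 1]
    have "((\<lambda>k. arccos (k * a)) \<longlongrightarrow> arccos (1 * a)) (at 1 within {0..1})" by simp
    then show ?thesis by (simp only: at_within_Icc_at_left[OF zero_less_one])
  qed
  have "arccos (1 * D 1) \<le> arccos (1 * 1) + 1 * C"
  proof (rule tendsto_le)
    show "((\<lambda>k. arccos (k * D 1)) \<longlongrightarrow> arccos (1 * D 1)) (at_left 1)"
      using range[of 1] by (intro cts) auto
    show "((\<lambda>k. arccos (k * 1) + k * C) \<longlongrightarrow> arccos (1 * 1) + 1 * C) (at_left 1)"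
      by (intro tendsto_add cts tendsto_mult lim tendsto_const) simp
    show "\<forall>\<^sub>F k in at_left 1. arccos (k * D 1) \<le> arccos (k * 1) + k * C"
      using eventually_at_left_real[OF zero_less_one] by (rule eventually_mono) (use 1 in auto)
  qed simp
  then show ?thesis by simp
qed

subsection \<open>Completeness of \<open>L\<^sup>2\<close>\<close>

interpretation circle: finite_measure circle_measure
  by standard (simp add: emeasure_circle_measure)

lemma measure_circle_measure: "measure circle_measure (space circle_measure) = 1"
  by (simp add: measure_def emeasure_circle_measure)

lemma ae_equal_refl: "square_integrable f \<Longrightarrow> ae_equal f f"
  by (simp add: ae_equal_def)

lemma abs_l2_circle_eq: "ae_equal f g \<Longrightarrow> abs_l2_circle f = abs_l2_circle g"
  using Quotient3_rel_abs[OF Quotient3_l2_circle] .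

lemma l2_circle_cases:
  obtains F where "square_integrable F" "f = abs_l2_circle F"
proof (induction f rule: l2_circle.abs_induct)
  case (1 y)
  then show ?case by (auto simp: ae_equal_def)
qed

lemma minus_abs_l2_circle:
  assumes "square_integrable F" "square_integrable G"
  shows "abs_l2_circle F - abs_l2_circle G = abs_l2_circle (\<lambda>z. F z - G z)"
proof -
  have "square_integrable (\<lambda>z. - G z)" using square_integrable_cmult[OF assms(2), of "-1"] by simp
  then show ?thesis using assms
    by (simp add: minus_l2_circle_def uminus_l2_circle.abs_eq plus_l2_circle.abs_eq ae_equal_refl)
qed

lemma norm_abs_l2_circle:
  assumes "square_integrable F"
  shows "(norm (abs_l2_circle F))\<^sup>2 = (\<integral>z. (cmod (F z))\<^sup>2 \<partial>circle_measure)"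
proof -
  have "(norm (abs_l2_circle F))\<^sup>2 = Re (\<integral>z. F z * cnj (F z) \<partial>circle_measure)"
    by (simp only: power2_norm_eq_inner[of "abs_l2_circle F"] inner_l2_circle_def
        cinner.abs_eq[OF ae_equal_refl[OF assms] ae_equal_refl[OF assms]])
  then show ?thesis
    by (simp only: complex_norm_square[symmetric] integral_complex_of_real Re_complex_of_real)
qed

lemma square_integrable_integrable: "square_integrable F \<Longrightarrow> integrable circle_measure F"
  using integrable_mult_cnj[of F "\<lambda>z. 1"]
  by (simp add: square_integrable_def)

lemma square_integrable_diff:
  "square_integrable F \<Longrightarrow> square_integrable G \<Longrightarrow> square_integrable (\<lambda>z. F z - G z)"
  using square_integrable_add[of F "\<lambda>z. - G z"] square_integrable_cmult[of G "-1"] by simp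

text \<open>Cauchy-Schwarz for the modulus of \<open>F\<close> against the constant 1, whose norm is
  1 because the measure has total mass 1. It turns L2-Cauchy sequences into L1-Cauchy ones.\<close>

lemma L1_le_L2:
  assumes "square_integrable F"
  shows "(\<integral>z. cmod (F z) \<partial>circle_measure) \<le> norm (abs_l2_circle F)"
proof -
  define G where "G z = complex_of_real (cmod (F z))" for z
  have F: "F \<in> borel_measurable circle_measure" "integrable circle_measure (\<lambda>z. (cmod (F z))\<^sup>2)"
    using assms by (auto simp: square_integrable_def)
  then have G: "square_integrable G" by (simp add: square_integrable_def G_def[abs_def])
  have one: "square_integrable (\<lambda>z. 1)" by (simp add: square_integrable_def)
  have "(\<integral>z. cmod (F z) \<partial>circle_measure) = inner (abs_l2_circle G) (abs_l2_circle (\<lambda>z. 1))"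
    unfolding inner_l2_circle_def cinner.abs_eq[OF ae_equal_refl[OF G] ae_equal_refl[OF one]]
    by (simp add: G_def)
  also have "\<dots> \<le> norm (abs_l2_circle G) * norm (abs_l2_circle (\<lambda>z. 1))"
    by (rule norm_cauchy_schwarz)
  also have "(norm (abs_l2_circle (\<lambda>z. 1)))\<^sup>2 = 1"
    unfolding norm_abs_l2_circle[OF one] by (simp add: measure_circle_measure)
  then have "norm (abs_l2_circle (\<lambda>z. 1)) = 1"
    by (simp add: power2_eq_1_iff) (use norm_ge_zero in \<open>smt (verit)\<close>)
  also have "(norm (abs_l2_circle G))\<^sup>2 = (norm (abs_l2_circle F))\<^sup>2"
    unfolding norm_abs_l2_circle[OF G] norm_abs_l2_circle[OF assms] by (simp add: G_def)
  then have "norm (abs_l2_circle G) = norm (abs_l2_circle F)" by simp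
  finally show ?thesis by simp
qed

text \<open>Fatou's lemma for the squared moduli. The same estimate shows first that the pointwise
  limit is square integrable and then that its norm obeys the bound.\<close>

lemma L2_Fatou:
  fixes F :: "nat \<Rightarrow> complex \<Rightarrow> complex"
  assumes F: "\<And>n. square_integrable (F n)" and G: "G \<in> borel_measurable circle_measure"
    and lim: "AE z in circle_measure. (\<lambda>n. F n z) \<longlonglongrightarrow> G z"
    and bd: "\<forall>\<^sub>F n in sequentially. norm (abs_l2_circle (F n)) \<le> e"
  shows "square_integrable G" "norm (abs_l2_circle G) \<le> e"
proof -
  have [measurable]: "F n \<in> borel_measurable circle_measure" "G \<in> borel_measurable circle_measure" for n
    using F G by (auto simp: square_integrable_def)
  obtain n where "norm (abs_l2_circle (F n)) \<le> e"
    using bd by (auto simp: eventually_sequentially)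
  then have e: "0 \<le> e" using norm_ge_zero order_trans by blast
  have "(\<integral>\<^sup>+z. ennreal ((cmod (G z))\<^sup>2) \<partial>circle_measure)
      = (\<integral>\<^sup>+z. liminf (\<lambda>n. ennreal ((cmod (F n z))\<^sup>2)) \<partial>circle_measure)"
  proof (rule nn_integral_cong_AE)
    show "AE z in circle_measure. ennreal ((cmod (G z))\<^sup>2) = liminf (\<lambda>n. ennreal ((cmod (F n z))\<^sup>2))"
      using lim
    proof eventually_elim
      case (elim z)
      then have "(\<lambda>n. ennreal ((cmod (F n z))\<^sup>2)) \<longlonglongrightarrow> ennreal ((cmod (G z))\<^sup>2)"
        by (intro tendsto_intros tendsto_ennrealI)
      then show ?case by (intro lim_imp_Liminf[symmetric] sequentially_bot)
    qed
  qed
  also have "\<dots> \<le> liminf (\<lambda>n. \<integral>\<^sup>+z. ennreal ((cmod (F n z))\<^sup>2) \<partial>circle_measure)"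
    by (rule nn_integral_liminf) measurable
  also have "\<dots> = liminf (\<lambda>n. ennreal ((norm (abs_l2_circle (F n)))\<^sup>2))"
    using F by (subst nn_integral_eq_integral) (auto simp: square_integrable_def norm_abs_l2_circle)
  also have "\<dots> \<le> limsup (\<lambda>n. ennreal ((norm (abs_l2_circle (F n)))\<^sup>2))"
    by (intro Liminf_le_Limsup sequentially_bot)
  also have "\<dots> \<le> ennreal (e\<^sup>2)"
    by (rule Limsup_bounded) (use bd in \<open>eventually_elim, auto intro!: ennreal_leI power_mono\<close>)
  finally have le: "(\<integral>\<^sup>+z. ennreal ((cmod (G z))\<^sup>2) \<partial>circle_measure) \<le> ennreal (e\<^sup>2)" .
  have "integrable circle_measure (\<lambda>z. (cmod (G z))\<^sup>2)"
    by (rule integrableI_bounded) (use le in \<open>auto intro: order.strict_trans1\<close>)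
  then show G2: "square_integrable G" by (simp add: square_integrable_def)
  have "ennreal ((norm (abs_l2_circle G))\<^sup>2) \<le> ennreal (e\<^sup>2)"
    using le G2 unfolding norm_abs_l2_circle[OF G2]
    by (subst (asm) nn_integral_eq_integral) (auto simp: square_integrable_def)
  then have "(norm (abs_l2_circle G))\<^sup>2 \<le> e\<^sup>2" by (simp add: ennreal_le_iff)
  then show "norm (abs_l2_circle G) \<le> e" using e by (rule power2_le_imp_le)
qed

text \<open>Fatou is applied to the differences from a fixed term rather than to the sequence
  itself. This gives at once that the pointwise limit lies in L2 and that the whole sequence, not
  only the subsequence, converges to it.\<close>

instance l2_circle :: complete_space
proof
  fix X :: "nat \<Rightarrow> l2_circle" assume X: "Cauchy X"
  have "\<exists>F. square_integrable F \<and> X n = abs_l2_circle F" for n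
    using l2_circle_cases by blast
  then obtain F where F: "\<And>n. square_integrable (F n)" "\<And>n. X n = abs_l2_circle (F n)"
    by metis
  have diff: "X m - X n = abs_l2_circle (\<lambda>z. F m z - F n z)" for m n
    by (simp add: F minus_abs_l2_circle)
  have [measurable]: "F n \<in> borel_measurable circle_measure" for n
    using F by (auto simp: square_integrable_def)
  \<comment> \<open>Almost everywhere convergence of a subsequence is available for L1-Cauchy
    sequences, so the L2 distances are first weakened to L1 distances.\<close>
  obtain r where r: "strict_mono r" "AE z in circle_measure. Cauchy (\<lambda>n. F (r n) z)"
  proof (rule cauchy_L1_AE_cauchy_subseq[of circle_measure F])
    show "integrable circle_measure (F n)" for n using F by (simp add: square_integrable_integrable)
    fix e :: real assume "e > 0"
    then obtain N where N: "\<And>m n. m \<ge> N \<Longrightarrow> n \<ge> N \<Longrightarrow> norm (X m - X n) < e"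
      using X unfolding Cauchy_def dist_norm by meson
    show "\<exists>N. \<forall>i\<ge>N. \<forall>j\<ge>N. (LINT z|circle_measure. cmod (F i z - F j z)) < e"
      using N L1_le_L2[OF square_integrable_diff[OF F(1) F(1)]] unfolding diff
      by (meson order.strict_trans1)
  qed
  define G where "G z = lim (\<lambda>n. F (r n) z)" for z
  have [measurable]: "G \<in> borel_measurable circle_measure"
    unfolding G_def by (rule borel_measurable_lim_metric) measurable
  have lim: "AE z in circle_measure. (\<lambda>n. F (r n) z) \<longlonglongrightarrow> G z"
    using r(2) by eventually_elim (simp add: G_def Cauchy_convergent_iff convergent_LIMSEQ_iff)
  have close: "\<exists>N. \<forall>m\<ge>N. square_integrable (\<lambda>z. F m z - G z) \<and> norm (abs_l2_circle (\<lambda>z. F m z - G z)) \<le> e"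
    if "e > 0" for e
  proof -
    obtain N where N: "\<And>m n. m \<ge> N \<Longrightarrow> n \<ge> N \<Longrightarrow> norm (X m - X n) < e"
      using X \<open>e > 0\<close> unfolding Cauchy_def dist_norm by meson
    \<comment> \<open>Here \<open>m\<close> is fixed and only \<open>n\<close> tends to infinity
      along \<open>r\<close>; the bound on \<open>X m - X (r n)\<close> passes to the limit.\<close>
    have "square_integrable (\<lambda>z. F m z - G z) \<and> norm (abs_l2_circle (\<lambda>z. F m z - G z)) \<le> e"
      if m: "m \<ge> N" for m
    proof -
      have bd: "\<forall>\<^sub>F n in sequentially. norm (abs_l2_circle (\<lambda>z. F m z - F (r n) z)) \<le> e"
        using eventually_ge_at_top[of N]
      proof eventually_elim
        case (elim n)
        then have "r n \<ge> N" using seq_suble[OF r(1), of n] by simp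
        then show ?case using N[OF m, of "r n"] by (simp add: diff)
      qed
      have lim': "AE z in circle_measure. (\<lambda>n. F m z - F (r n) z) \<longlonglongrightarrow> F m z - G z"
        using lim by eventually_elim (intro tendsto_intros)
      show ?thesis
        using L2_Fatou[where F = "\<lambda>n z. F m z - F (r n) z", OF square_integrable_diff[OF F(1) F(1)] _ lim' bd]
        by simp
    qed
    then show ?thesis by blast
  qed
  obtain m where "square_integrable (\<lambda>z. F m z - G z)" using close[of 1] by auto
  from square_integrable_diff[OF F(1)[of m] this] have G: "square_integrable G" by simp
  have "X \<longlonglongrightarrow> abs_l2_circle G"
  proof (rule LIMSEQ_I)
    fix e :: real assume "e > 0"
    then obtain N where N: "\<And>m. m \<ge> N \<Longrightarrow> norm (abs_l2_circle (\<lambda>z. F m z - G z)) \<le> e / 2"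
      using close[of "e / 2"] by auto
    have "norm (X m - abs_l2_circle G) < e" if "m \<ge> N" for m
      using N[OF that] \<open>e > 0\<close> by (simp add: F minus_abs_l2_circle[OF F(1) G])
    then show "\<exists>N. \<forall>m\<ge>N. norm (X m - abs_l2_circle G) < e" by blast
  qed
  then show "convergent X" by (auto simp: convergent_def)
qed

subsection \<open>Multiplication operators and the Riesz projection\<close>

lemma cnj_measurable [measurable (raw)]:
  "f \<in> borel_measurable M \<Longrightarrow> (\<lambda>z. cnj (f z)) \<in> borel_measurable M"
  by (rule borel_measurable_continuous_on[OF continuous_on_cnj[OF continuous_on_id]])

lemma Linf_mult:
  fixes \<phi> \<psi> :: "complex \<Rightarrow> 'a::{real_normed_algebra, second_countable_topology}"
  assumes "\<phi> \<in> Linf" "\<psi> \<in> Linf"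
  shows "(\<lambda>z. \<phi> z * \<psi> z) \<in> Linf"
proof -
  obtain A B where A: "AE z in circle_measure. norm (\<phi> z) \<le> A"
    and B: "AE z in circle_measure. norm (\<psi> z) \<le> B"
    using assms by (auto simp: Linf_def)
  have "AE z in circle_measure. norm (\<phi> z * \<psi> z) \<le> A * B"
    using A B
  proof eventually_elim
    case (elim z)
    then have "norm (\<phi> z) * norm (\<psi> z) \<le> A * B"
      using norm_ge_zero[of "\<phi> z"] by (intro mult_mono) (linarith | simp)+
    then show ?case by (rule order_trans[OF norm_mult_ineq])
  qed
  then show ?thesis using assms by (auto simp: Linf_def)
qed

lemma Linf_cnj: "\<phi> \<in> Linf \<Longrightarrow> (\<lambda>z. cnj (\<phi> z)) \<in> Linf"
  by (auto simp: Linf_def)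

lemma Linf_of_real: "\<theta> \<in> Linf \<Longrightarrow> (\<lambda>z. complex_of_real (\<theta> z)) \<in> Linf"
  by (auto simp: Linf_def)

lemma Linf_cis:
  assumes "\<theta> \<in> Linf"
  shows "(\<lambda>z. cis (\<theta> z)) \<in> Linf"
proof -
  have "cis \<in> borel_measurable borel"
    by (intro borel_measurable_continuous_onI continuous_intros)
  then have "(\<lambda>z. cis (\<theta> z)) \<in> borel_measurable circle_measure"
    using assms by (auto simp: Linf_def intro: measurable_compose)
  then show ?thesis by (auto simp: Linf_def intro!: exI[of _ 1])
qed

lemma mult_op_abs:
  "\<phi> \<in> Linf \<Longrightarrow> square_integrable F \<Longrightarrow>
    mult_op \<phi> (abs_l2_circle F) = abs_l2_circle (\<lambda>z. \<phi> z * F z)"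
  by (simp add: mult_op.abs_eq[OF ae_equal_refl])

lemma cinner_commute: "cinner f g = cnj (cinner g f)"
  by transfer (subst Bochner_Integration.integral_cnj[symmetric], simp add: mult.commute)

lemma cinner_add_left: "cinner (f + g) h = cinner f h + cinner g h"
  by transfer (auto simp: ae_equal_def distrib_right integrable_mult_cnj)

lemma cinner_scaleR_left: "cinner (r *\<^sub>R f) g = complex_of_real r * cinner f g"
  by transfer (simp add: mult.assoc)

lemma cinner_zero_left [simp]: "cinner 0 g = 0"
  using cinner_scaleR_left[of 0 0 g] by simp

lemma cinner_mult_op_left:
  assumes "\<phi> \<in> Linf"
  shows "cinner (mult_op \<phi> f) g = cinner f (mult_op (\<lambda>z. cnj (\<phi> z)) g)"
proof -
  obtain F G where FG: "square_integrable F" "f = abs_l2_circle F"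
    "square_integrable G" "g = abs_l2_circle G"
    using l2_circle_cases by metis
  show ?thesis
    using FG assms Linf_cnj[OF assms]
    by (simp add: mult_op_abs cinner.abs_eq ae_equal_refl square_integrable_mult)
      (simp add: mult_ac)
qed

lemma cinner_mult_op_const_left: "cinner (mult_op (\<lambda>z. c) f) g = c * cinner f g"
proof -
  obtain F G where FG: "square_integrable F" "f = abs_l2_circle F"
    "square_integrable G" "g = abs_l2_circle G"
    using l2_circle_cases by metis
  show ?thesis
    using FG
    by (simp add: mult_op_abs const_in_Linf cinner.abs_eq ae_equal_refl square_integrable_cmult mult.assoc)
qed

text \<open>The real inner product determines the complex one: its imaginary part is seen by
  rotating one argument by \<open>\<i>\<close>. This lets real Hilbert space arguments be used for
  complex orthogonality.\<close>

lemma cinner_eq_Complex_inner: "cinner f g = Complex (inner f g) (inner f (mult_op (\<lambda>z. \<i>) g))"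
proof -
  have "cinner f (mult_op (\<lambda>z. \<i>) g) = cnj (\<i> * cinner g f)"
    using cinner_commute[of f] by (simp add: cinner_mult_op_const_left)
  also have "\<dots> = - \<i> * cinner f g"
    using cinner_commute[of f g] by simp
  finally show ?thesis by (simp add: inner_l2_circle_def complex_eq_iff)
qed

lemma mult_op_cong_AE:
  assumes "\<phi> \<in> Linf" "\<psi> \<in> Linf" "AE z in circle_measure. \<phi> z = \<psi> z"
  shows "mult_op \<phi> f = mult_op \<psi> f"
proof -
  obtain F where F: "square_integrable F" "f = abs_l2_circle F" using l2_circle_cases .
  have "ae_equal (\<lambda>z. \<phi> z * F z) (\<lambda>z. \<psi> z * F z)"
    using assms F by (auto simp: ae_equal_def square_integrable_mult elim: eventually_mono)
  then show ?thesis using assms F by (simp add: mult_op_abs abs_l2_circle_eq)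
qed

lemma mult_op_mult_op:
  assumes "\<phi> \<in> Linf" "\<psi> \<in> Linf"
  shows "mult_op \<phi> (mult_op \<psi> f) = mult_op (\<lambda>z. \<phi> z * \<psi> z) f"
proof -
  obtain F where F: "square_integrable F" "f = abs_l2_circle F" using l2_circle_cases .
  then show ?thesis
    using assms by (simp add: mult_op_abs square_integrable_mult Linf_mult mult.assoc)
qed

lemma mult_op_one: "mult_op (\<lambda>z. 1) f = f"
proof -
  obtain F where F: "square_integrable F" "f = abs_l2_circle F" using l2_circle_cases .
  then show ?thesis by (simp add: mult_op_abs const_in_Linf)
qed

lemma norm_mult_op_le:
  assumes "\<phi> \<in> Linf" and C: "AE z in circle_measure. cmod (\<phi> z) \<le> C"
  shows "norm (mult_op \<phi> f) \<le> C * norm f"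
proof -
  obtain F where F: "square_integrable F" "f = abs_l2_circle F" using l2_circle_cases .
  \<comment> \<open>The measure is nonzero, so the almost everywhere bound holds at some point; this
    makes \<open>C\<close> nonnegative, as needed to take square roots at the end.\<close>
  have "ae_filter circle_measure \<noteq> bot"
    by (simp add: ae_filter_eq_bot_iff emeasure_circle_measure)
  with C obtain z where "cmod (\<phi> z) \<le> C"
    using eventually_happens' by blast
  then have C0: "0 \<le> C" using norm_ge_zero order_trans by blast
  have "(norm (mult_op \<phi> f))\<^sup>2 = (\<integral>z. (cmod (\<phi> z * F z))\<^sup>2 \<partial>circle_measure)"
    using F assms(1) by (simp add: mult_op_abs norm_abs_l2_circle square_integrable_mult)
  also have "\<dots> \<le> (\<integral>z. C\<^sup>2 * (cmod (F z))\<^sup>2 \<partial>circle_measure)"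
  proof (rule integral_mono_AE)
    show "AE z in circle_measure. (cmod (\<phi> z * F z))\<^sup>2 \<le> C\<^sup>2 * (cmod (F z))\<^sup>2"
      using C
    proof eventually_elim
      case (elim z)
      then have "(cmod (\<phi> z))\<^sup>2 \<le> C\<^sup>2" by (simp add: power_mono)
      then show ?case by (simp add: norm_mult power_mult_distrib mult_right_mono)
    qed
    show "integrable circle_measure (\<lambda>z. (cmod (\<phi> z * F z))\<^sup>2)"
      using square_integrable_mult[OF assms(1) F(1)] by (simp add: square_integrable_def)
    show "integrable circle_measure (\<lambda>z. C\<^sup>2 * (cmod (F z))\<^sup>2)"
      using F(1) by (simp add: square_integrable_def)
  qed
  also have "\<dots> = (C * norm f)\<^sup>2"
    using F by (simp add: norm_abs_l2_circle power_mult_distrib)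
  finally show ?thesis by (rule power2_le_imp_le) (simp add: C0)
qed

lemma bounded_linear_mult_op:
  assumes "\<phi> \<in> Linf"
  shows "bounded_linear (mult_op \<phi>)"
proof -
  obtain C where C: "AE z in circle_measure. cmod (\<phi> z) \<le> C"
    using assms by (auto simp: Linf_def)
  show ?thesis
  proof (rule bounded_linear_intro)
    show "mult_op \<phi> (f + g) = mult_op \<phi> f + mult_op \<phi> g" for f g
    proof -
      obtain F G where FG: "square_integrable F" "f = abs_l2_circle F"
        "square_integrable G" "g = abs_l2_circle G"
        using l2_circle_cases by metis
      then show ?thesis
        using assms by (simp add: mult_op_abs plus_l2_circle.abs_eq ae_equal_refl
            square_integrable_mult square_integrable_add distrib_left)
    qed
    show "mult_op \<phi> (r *\<^sub>R f) = r *\<^sub>R mult_op \<phi> f" for r f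
    proof -
      obtain F where "square_integrable F" "f = abs_l2_circle F" using l2_circle_cases .
      then show ?thesis
        using assms by (simp add: mult_op_abs scaleR_l2_circle.abs_eq ae_equal_refl
            square_integrable_mult square_integrable_cmult mult.left_commute)
    qed
    show "norm (mult_op \<phi> f) \<le> norm f * C" for f
      using norm_mult_op_le[OF assms C] by (simp add: mult.commute)
  qed
qed

text \<open>The adjoint of \<open>mult_op \<phi>\<close> is multiplication by the conjugate symbol,
  and the product of the two symbols is 1 almost everywhere.\<close>

lemma norm_mult_op_unimodular:
  assumes "\<phi> \<in> Linf" "unimodular \<phi>"
  shows "norm (mult_op \<phi> f) = norm f"
proof -
  have "mult_op (\<lambda>z. cnj (\<phi> z)) (mult_op \<phi> f) = mult_op (\<lambda>z. cnj (\<phi> z) * \<phi> z) f"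
    using assms by (simp add: mult_op_mult_op Linf_cnj)
  also have "\<dots> = mult_op (\<lambda>z. 1) f"
  proof (rule mult_op_cong_AE)
    show "AE z in circle_measure. cnj (\<phi> z) * \<phi> z = 1"
      using assms(2) unfolding unimodular_def
      by eventually_elim (metis complex_norm_square mult.commute of_real_1 power_one)
  qed (use assms in \<open>simp_all add: Linf_mult Linf_cnj const_in_Linf\<close>)
  also have "\<dots> = f" by (rule mult_op_one)
  finally have "inner (mult_op \<phi> f) (mult_op \<phi> f) = inner f f"
    using assms(1) by (simp add: inner_l2_circle_def cinner_mult_op_left)
  then show ?thesis by (simp add: norm_eq_sqrt_inner)
qed

lemma norm_monomial_0: "norm (monomial 0) = 1"
proof -
  have one: "square_integrable (\<lambda>z. 1)" by (simp add: square_integrable_def)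
  have "(norm (monomial 0))\<^sup>2 = 1"
    by (simp add: monomial.abs_eq norm_abs_l2_circle one measure_circle_measure)
  then show ?thesis by (simp add: power2_eq_1_iff) (use norm_ge_zero in \<open>smt (verit)\<close>)
qed

section \<open>The Hardy space and its orthogonal projection\<close>

text \<open>Each complex condition on a Fourier coefficient splits into two real ones. As zero sets
  of continuous real functionals they make \<open>H2\<close> visibly closed.\<close>

lemma H2_eq_orthogonal_complement: "H2 = (\<Inter>n\<in>{..<0}. {f. inner f (monomial n) = 0} \<inter>
    {f. inner f (mult_op (\<lambda>z. \<i>) (monomial n)) = 0})"
  by (auto simp: H2_def fourier_coeff_def cinner_eq_Complex_inner complex_eq_iff)

lemma closed_H2: "closed H2"
  unfolding H2_eq_orthogonal_complement
  by (intro closed_INT ballI closed_Int closed_Collect_eq continuous_intros)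

lemma subspace_H2: "subspace H2"
  by (auto simp: subspace_def H2_def fourier_coeff_def cinner_add_left cinner_scaleR_left)

lemma mult_op_const_H2: "f \<in> H2 \<Longrightarrow> mult_op (\<lambda>z. c) f \<in> H2"
  by (simp add: H2_def fourier_coeff_def cinner_mult_op_const_left)

text \<open>Real orthogonality suffices, since \<open>H2\<close> is invariant under multiplication
  by \<open>\<i>\<close>. Two candidates agree because their difference lies in \<open>H2\<close>
  and is orthogonal to both residuals, hence to itself.\<close>

lemma P_plus_unique:
  assumes "g \<in> H2" "\<And>h. h \<in> H2 \<Longrightarrow> inner (f - g) h = 0"
  shows "P_plus f = g"
  unfolding P_plus_def
proof (rule the_equality)
  show "g \<in> H2 \<and> (\<forall>h\<in>H2. cinner (f - g) h = 0)"
    using assms by (auto simp: cinner_eq_Complex_inner mult_op_const_H2 complex_eq_iff)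
  fix g' assume g': "g' \<in> H2 \<and> (\<forall>h\<in>H2. cinner (f - g') h = 0)"
  then have "inner (f - g') h = 0" if "h \<in> H2" for h
    using that by (simp add: inner_l2_circle_def)
  then have "inner (f - g) (g - g') = 0" "inner (f - g') (g - g') = 0"
    using assms g' subspace_diff[OF subspace_H2] by auto
  then have "inner (g - g') (g - g') = 0" by (simp add: inner_diff_left)
  then show "g' = g" by simp
qed

lemma P_plus_in_H2: "P_plus f \<in> H2"
  and inner_diff_P_plus: "h \<in> H2 \<Longrightarrow> inner (f - P_plus f) h = 0"
proof -
  obtain g where g: "g \<in> H2" "\<And>h. h \<in> H2 \<Longrightarrow> inner (f - g) h = 0"
    using orthogonal_projection_exists[OF subspace_H2 closed_H2] by metis
  then have "P_plus f = g" by (rule P_plus_unique)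
  with g show "P_plus f \<in> H2" "h \<in> H2 \<Longrightarrow> inner (f - P_plus f) h = 0" by auto
qed

lemma P_plus_H2: "f \<in> H2 \<Longrightarrow> P_plus f = f"
  by (rule P_plus_unique) auto

lemma norm_P_plus_Pythagoras: "(norm f)\<^sup>2 = (norm (P_plus f))\<^sup>2 + (norm (f - P_plus f))\<^sup>2"
proof -
  have "inner (f - P_plus f) (P_plus f) = 0" using inner_diff_P_plus P_plus_in_H2 by blast
  then have "(norm (P_plus f + (f - P_plus f)))\<^sup>2 = (norm (P_plus f))\<^sup>2 + (norm (f - P_plus f))\<^sup>2"
    by (intro norm_add_Pythagorean) (simp add: orthogonal_def inner_commute)
  then show ?thesis by simp
qed

lemma norm_P_plus_le: "norm (P_plus f) \<le> norm f"
proof (rule power2_le_imp_le)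
  show "(norm (P_plus f))\<^sup>2 \<le> (norm f)\<^sup>2" using norm_P_plus_Pythagoras[of f] by simp
qed simp

lemma bounded_linear_P_plus: "bounded_linear P_plus"
proof (rule bounded_linear_intro)
  show "P_plus (f + g) = P_plus f + P_plus g" for f g
  proof (rule P_plus_unique)
    show "P_plus f + P_plus g \<in> H2" by (intro subspace_add subspace_H2 P_plus_in_H2)
    show "inner (f + g - (P_plus f + P_plus g)) h = 0" if "h \<in> H2" for h
      using inner_diff_P_plus[OF that, of f] inner_diff_P_plus[OF that, of g]
      by (simp add: inner_diff_left inner_add_left)
  qed
  show "P_plus (r *\<^sub>R f) = r *\<^sub>R P_plus f" for r f
  proof (rule P_plus_unique)
    show "r *\<^sub>R P_plus f \<in> H2" by (intro subspace_scale subspace_H2 P_plus_in_H2)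
    show "inner (r *\<^sub>R f - r *\<^sub>R P_plus f) h = 0" if "h \<in> H2" for h
      using inner_diff_P_plus[OF that, of f] by (simp add: inner_diff_left)
  qed
  show "norm (P_plus f) \<le> norm f * 1" for f using norm_P_plus_le by simp
qed

lemma integral_circle_measure:
  fixes F :: "complex \<Rightarrow> complex"
  assumes [measurable]: "F \<in> borel_measurable (restrict_space borel (sphere 0 1))"
  shows "(\<integral>z. F z \<partial>circle_measure)
    = (\<integral>t. (indicator {0..2 * pi} t / (2 * pi)) *\<^sub>R F (cis t) \<partial>lborel)"
proof -
  have "cis \<in> borel_measurable borel"
    by (intro borel_measurable_continuous_onI continuous_intros)
  then have cis [measurable]: "cis \<in> borel \<rightarrow>\<^sub>M restrict_space borel (sphere 0 1)"
    by (intro measurable_restrict_space2) auto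
  \<comment> \<open>The extended nonnegative density is rewritten as the image of a real function,
    so that it can be moved into a Bochner integral as a scalar factor.\<close>
  have "uniform_measure lborel {0..2 * pi} = density lborel (\<lambda>t. ennreal (indicator {0..2 * pi} t / (2 * pi)))"
    unfolding uniform_measure_def
    by (rule arg_cong[where f = "density lborel"])
      (auto simp: fun_eq_iff divide_ennreal[symmetric] ennreal_indicator[symmetric] simp del: ennreal_indicator)
  moreover have "(\<integral>z. F z \<partial>circle_measure) = (\<integral>t. F (cis t) \<partial>uniform_measure lborel {0..2 * pi})"
    unfolding circle_measure_def by (rule integral_distr[OF cis_measurable]) measurable
  ultimately show ?thesis by (simp add: integral_density)
qed

text \<open>Provides a unit vector of \<open>H2\<close>, so that the infimum defining the reduced
  minimum modulus is over a nonempty set. The coefficients are integrals of nontrivial characters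
  over a full period.\<close>

lemma monomial_0_in_H2: "monomial 0 \<in> H2"
  unfolding H2_def fourier_coeff_def
proof (intro CollectI allI impI)
  fix n :: int assume n: "n < 0"
  have ae: "ae_equal (\<lambda>z. z powi m) (\<lambda>z. z powi m)" for m
    using rel_funD[OF monomial.rsp refl, of m] by simp
  \<comment> \<open>The sign comes from conjugation: on the circle the conjugate of
    \<open>cis t powi n\<close> is \<open>cis (k * t)\<close>. As \<open>k\<close> is nonzero,
    dividing by it gives an antiderivative.\<close>
  define k where "k = - real_of_int n"
  have k: "k \<noteq> 0" using n by (simp add: k_def)
  have "cinner (monomial 0) (monomial n) = (\<integral>z. cnj (z powi n) \<partial>circle_measure)"
    by (simp add: monomial.abs_eq cinner.abs_eq[OF ae ae, of 0, simplified])
  also have "\<dots> = (\<integral>t. (indicator {0..2 * pi} t / (2 * pi)) *\<^sub>R cnj (cis t powi n) \<partial>lborel)"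
  proof (rule integral_circle_measure)
    have "continuous_on (sphere 0 1) (\<lambda>z :: complex. cnj (z powi n))"
      by (auto intro!: continuous_intros)
    then show "(\<lambda>z. cnj (z powi n)) \<in> borel_measurable (restrict_space borel (sphere 0 1))"
      by (rule borel_measurable_continuous_on_restrict)
  qed
  also have "\<dots> = (\<integral>t. indicator {0..2 * pi} t *\<^sub>R (cis (k * t) / (2 * pi)) \<partial>lborel)"
    by (intro Bochner_Integration.integral_cong)
      (auto simp: k_def cis_power_int cis_cnj scaleR_conv_of_real field_simps split: split_indicator)
  also have "\<dots> = cis (k * (2 * pi)) / (2 * pi * (\<i> * k)) - cis (k * 0) / (2 * pi * (\<i> * k))"
  proof (rule integral_FTC_atLeastAtMost)
    fix t :: real
    have "((\<lambda>z. exp (\<i> * (of_real k * z)) / (2 * pi * (\<i> * k))) has_field_derivative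
        exp (\<i> * (of_real k * of_real t)) / (2 * pi)) (at (of_real t))"
      using k by (auto intro!: derivative_eq_intros)
    from has_vector_derivative_real_field[OF this]
    show "((\<lambda>t. cis (k * t) / (2 * pi * (\<i> * k))) has_vector_derivative cis (k * t) / (2 * pi))
        (at t within {0..2 * pi})"
      by (simp add: cis_conv_exp)
  next
    show "continuous_on {0..2 * pi} (\<lambda>t. cis (k * t) / (2 * pi))"
      by (intro continuous_intros) auto
  qed simp
  \<comment> \<open>Since \<open>k\<close> is an integer, the antiderivative takes equal values at
    the two endpoints.\<close>
  also have "cis (k * (2 * pi)) = 1"
    using cis_multiple_2pi[of k] by (simp add: k_def mult_ac)
  finally show "cinner (monomial 0) (monomial n) = 0" by simp
qed

lemma Linf_diff:
  assumes "\<phi> \<in> Linf" "\<psi> \<in> Linf"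
  shows "(\<lambda>z. \<phi> z - \<psi> z :: 'a::{real_normed_vector, second_countable_topology}) \<in> Linf"
proof -
  obtain A B where A: "AE z in circle_measure. norm (\<phi> z) \<le> A"
    and B: "AE z in circle_measure. norm (\<psi> z) \<le> B"
    using assms by (auto simp: Linf_def)
  have "AE z in circle_measure. norm (\<phi> z - \<psi> z) \<le> A + B"
    using A B
  proof eventually_elim
    case (elim z)
    then show ?case using norm_triangle_ineq4[of "\<phi> z" "\<psi> z"] by linarith
  qed
  then show ?thesis using assms by (auto simp: Linf_def)
qed

lemma mult_op_diff_left:
  assumes "\<phi> \<in> Linf" "\<psi> \<in> Linf"
  shows "mult_op (\<lambda>z. \<phi> z - \<psi> z) f = mult_op \<phi> f - mult_op \<psi> f"
proof -
  obtain F where "square_integrable F" "f = abs_l2_circle F" using l2_circle_cases .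
  then show ?thesis
    using assms by (simp add: mult_op_abs Linf_diff minus_abs_l2_circle square_integrable_mult
        left_diff_distrib)
qed

lemma mult_op_scaleR_left:
  assumes "\<phi> \<in> Linf"
  shows "mult_op (\<lambda>z. complex_of_real r * \<phi> z) f = r *\<^sub>R mult_op \<phi> f"
proof -
  obtain F where "square_integrable F" "f = abs_l2_circle F" using l2_circle_cases .
  then show ?thesis
    using assms by (simp add: mult_op_abs Linf_mult const_in_Linf scaleR_l2_circle.abs_eq
        ae_equal_refl square_integrable_mult mult.assoc)
qed

subsection \<open>The unitary group generated by the argument\<close>

text \<open>First-order Taylor expansion of \<open>exp\<close> on the imaginary axis, where the
  exponential factor of the remainder is 1.\<close>

lemma norm_cis_diff_le: "cmod (cis x - 1 - \<i> * x) \<le> x\<^sup>2"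
  using Taylor_exp[of "\<i> * x" 1] by (simp add: cis_conv_exp norm_mult diff_diff_eq power2_eq_square)

text \<open>As \<open>\<theta>\<close> is essentially bounded by some \<open>K\<close>, the Taylor
  remainder of the symbol is uniformly quadratic in \<open>s - t\<close>. The bound for
  multiplication operators turns this into differentiability in norm.\<close>

lemma has_vector_derivative_mult_op_cis:
  assumes \<theta>: "\<theta> \<in> Linf"
  shows "((\<lambda>t. mult_op (\<lambda>z. cis (t * \<theta> z)) f) has_vector_derivative
    mult_op (\<lambda>z. \<i> * \<theta> z) (mult_op (\<lambda>z. cis (t * \<theta> z)) f)) (at t)"
proof -
  have cisL: "(\<lambda>z. cis (s * \<theta> z)) \<in> Linf" for s
    using Linf_cis[OF Linf_mult[OF const_in_Linf \<theta>]] .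
  have i\<theta>: "(\<lambda>z. \<i> * complex_of_real (\<theta> z)) \<in> Linf"
    by (intro Linf_mult const_in_Linf Linf_of_real \<theta>)
  obtain K where K: "AE z in circle_measure. \<bar>\<theta> z\<bar> \<le> K"
    using \<theta> by (auto simp: Linf_def)
  define v where "v s = mult_op (\<lambda>z. cis (s * \<theta> z)) f" for s
  define v' where "v' = mult_op (\<lambda>z. \<i> * \<theta> z) (v t)"
  have bound: "norm (v s - v t - (s - t) *\<^sub>R v') \<le> ((s - t)\<^sup>2 * K\<^sup>2) * norm f" for s
  proof -
    have "v s - v t - (s - t) *\<^sub>R v' = mult_op (\<lambda>z. cis (s * \<theta> z) - cis (t * \<theta> z)
        - complex_of_real (s - t) * (\<i> * \<theta> z * cis (t * \<theta> z))) f"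
      unfolding v'_def v_def mult_op_mult_op[OF i\<theta> cisL]
      by (simp only: mult_op_diff_left mult_op_scaleR_left Linf_diff cisL Linf_mult const_in_Linf i\<theta>)
    moreover have "AE z in circle_measure. cmod (cis (s * \<theta> z) - cis (t * \<theta> z)
        - complex_of_real (s - t) * (\<i> * \<theta> z * cis (t * \<theta> z))) \<le> (s - t)\<^sup>2 * K\<^sup>2"
      using K
    proof eventually_elim
      case (elim z)
      \<comment> \<open>Splitting off the factor at time \<open>t\<close>, which has modulus 1,
        reduces the estimate to an expansion around 0.\<close>
      have "cis (s * \<theta> z) = cis (t * \<theta> z) * cis ((s - t) * \<theta> z)"
        by (simp add: cis_mult algebra_simps)
      then have "cis (s * \<theta> z) - cis (t * \<theta> z) - complex_of_real (s - t) * (\<i> * \<theta> z * cis (t * \<theta> z))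
          = cis (t * \<theta> z) * (cis ((s - t) * \<theta> z) - 1 - \<i> * ((s - t) * \<theta> z))"
        by (simp add: algebra_simps)
      then have "cmod (cis (s * \<theta> z) - cis (t * \<theta> z) - complex_of_real (s - t) * (\<i> * \<theta> z * cis (t * \<theta> z)))
          \<le> ((s - t) * \<theta> z)\<^sup>2"
        using norm_cis_diff_le[of "(s - t) * \<theta> z"] by (simp add: norm_mult)
      also have "\<dots> \<le> (s - t)\<^sup>2 * K\<^sup>2"
        unfolding power_mult_distrib
        using power_mono[OF elim abs_ge_zero, of 2] by (intro mult_left_mono) auto
      finally show ?case .
    qed
    ultimately show ?thesis
      by (simp only:) (intro norm_mult_op_le Linf_diff cisL Linf_mult const_in_Linf i\<theta>)
  qed
  have "(v has_derivative (\<lambda>h. h *\<^sub>R v')) (at t)"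
    unfolding has_derivative_at_alt
  proof (intro conjI allI impI bounded_linear_scaleR_left)
    fix e :: real assume e: "e > 0"
    define M where "M = K\<^sup>2 * norm f"
    have M: "0 \<le> M" by (simp add: M_def)
    show "\<exists>d>0. \<forall>s. norm (s - t) < d \<longrightarrow> norm (v s - v t - (s - t) *\<^sub>R v') \<le> e * norm (s - t)"
    proof (intro exI conjI allI impI)
      \<comment> \<open>Dividing by \<open>M + 1\<close> instead of \<open>M\<close> covers the case
        \<open>M = 0\<close>.\<close>
      show "0 < e / (M + 1)" using e M by simp
      fix s assume s: "norm (s - t) < e / (M + 1)"
      have "norm (v s - v t - (s - t) *\<^sub>R v') \<le> (\<bar>s - t\<bar> * M) * \<bar>s - t\<bar>"
        using bound[of s] by (simp add: M_def power2_eq_square mult_ac)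
      also have "\<bar>s - t\<bar> * M \<le> \<bar>s - t\<bar> * (M + 1)" by (intro mult_left_mono) auto
      also have "\<dots> \<le> e" using s M by (simp add: pos_less_divide_eq)
      finally show "norm (v s - v t - (s - t) *\<^sub>R v') \<le> e * norm (s - t)"
        by (simp add: mult_right_mono)
    qed
  qed
  then show ?thesis by (simp add: has_vector_derivative_def v_def[abs_def] v'_def)
qed

section \<open>Growth of the angle to the Hardy space\<close>

text \<open>Because \<open>\<theta>\<close> is real, conjugation changes the sign of the symbol, so
  the generator of the group is skew-adjoint.\<close>

lemma inner_mult_op_imaginary:
  assumes "\<theta> \<in> Linf"
  shows "inner (mult_op (\<lambda>z. \<i> * complex_of_real (\<theta> z)) f) g
    = - inner f (mult_op (\<lambda>z. \<i> * complex_of_real (\<theta> z)) g)"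
proof -
  have L: "(\<lambda>z. \<i> * complex_of_real (\<theta> z)) \<in> Linf"
    by (intro Linf_mult const_in_Linf Linf_of_real assms)
  have "inner (mult_op (\<lambda>z. \<i> * complex_of_real (\<theta> z)) f) g
      = inner f (mult_op (\<lambda>z. complex_of_real (- 1) * (\<i> * complex_of_real (\<theta> z))) g)"
    using L by (simp add: inner_l2_circle_def cinner_mult_op_left)
  then show ?thesis unfolding mult_op_scaleR_left[OF L] by simp
qed

text \<open>Only the part of \<open>\<theta> h\<close> outside \<open>H2\<close> is seen by
  \<open>g\<close>. Since \<open>h\<close> is fixed by \<open>P_plus\<close>, that part is the
  commutator applied to \<open>h\<close>; the factor \<open>\<i>\<close> preserves norms and
  \<open>H2\<close>.\<close>

lemma inner_commutator_bound:
  assumes \<theta>: "\<theta> \<in> Linf" and h: "h \<in> H2" and g: "\<And>k. k \<in> H2 \<Longrightarrow> inner g k = 0"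
  shows "\<bar>inner (mult_op (\<lambda>z. \<i> * complex_of_real (\<theta> z)) h) g\<bar>
    \<le> onorm (\<lambda>f. mult_op (\<lambda>z. complex_of_real (\<theta> z)) (P_plus f)
        - P_plus (mult_op (\<lambda>z. complex_of_real (\<theta> z)) f)) * norm h * norm g"
proof -
  define M where "M = mult_op (\<lambda>z. complex_of_real (\<theta> z))"
  have L: "(\<lambda>z. complex_of_real (\<theta> z)) \<in> Linf" by (rule Linf_of_real[OF \<theta>])
  have bl: "bounded_linear (\<lambda>f. M (P_plus f) - P_plus (M f))"
    unfolding M_def
    by (intro bounded_linear_sub bounded_linear_compose[OF bounded_linear_mult_op[OF L]]
        bounded_linear_compose[OF bounded_linear_P_plus] bounded_linear_P_plus bounded_linear_mult_op[OF L])
  define J where "J = mult_op (\<lambda>z. \<i>)"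
  interpret J: bounded_linear J unfolding J_def by (rule bounded_linear_mult_op[OF const_in_Linf])
  have "mult_op (\<lambda>z. \<i> * complex_of_real (\<theta> z)) h = J (M h)"
    unfolding J_def M_def by (rule mult_op_mult_op[OF const_in_Linf L, symmetric])
  also have "\<dots> = J (M h - P_plus (M h)) + J (P_plus (M h))"
    by (simp add: J.diff)
  finally have "inner (mult_op (\<lambda>z. \<i> * complex_of_real (\<theta> z)) h) g = inner (J (M h - P_plus (M h))) g"
    using g[OF mult_op_const_H2[OF P_plus_in_H2], of "\<i>" "M h"]
    by (simp add: inner_add_left inner_add_right J_def inner_commute)
  also have "\<bar>\<dots>\<bar> \<le> norm (J (M h - P_plus (M h))) * norm g" by (rule Cauchy_Schwarz_ineq2)
  also have "norm (J (M h - P_plus (M h))) = norm (M (P_plus h) - P_plus (M h))"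
    by (simp add: J_def norm_mult_op_unimodular const_in_Linf unimodular_def P_plus_H2[OF h])
  also have "\<dots> * norm g \<le> onorm (\<lambda>f. M (P_plus f) - P_plus (M f)) * norm h * norm g"
    by (intro mult_right_mono onorm[OF bl] norm_ge_zero)
  finally show ?thesis by (simp add: M_def)
qed

text \<open>Splitting \<open>v t\<close> into \<open>h\<close> in \<open>H2\<close> and
  \<open>g\<close> orthogonal to it gives \<open>D' = - 4 * inner (A h) g\<close>, while
  \<open>sqrt (1 - D^2)\<close> is \<open>2 * norm h * norm g\<close>. The commutator bound thus
  controls the growth of the doubled angle.\<close>

lemma arccos_norm_toeplitz_le:
  assumes \<theta>: "\<theta> \<in> Linf" and f: "f \<in> H2" "norm f = 1"
  shows "arccos (norm (P_plus (mult_op (\<lambda>z. cis (\<theta> z)) f)))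
    \<le> onorm (\<lambda>f. mult_op (\<lambda>z. complex_of_real (\<theta> z)) (P_plus f)
        - P_plus (mult_op (\<lambda>z. complex_of_real (\<theta> z)) f))"
    (is "_ \<le> ?c")
proof -
  define v where "v t = mult_op (\<lambda>z. cis (t * \<theta> z)) f" for t
  define A where "A = mult_op (\<lambda>z. \<i> * complex_of_real (\<theta> z))"
  define D where "D t = 2 * inner (P_plus (v t)) (P_plus (v t)) - 1" for t
  interpret A: bounded_linear A
    unfolding A_def by (intro bounded_linear_mult_op Linf_mult const_in_Linf Linf_of_real \<theta>)
  have cisL: "(\<lambda>z. cis (t * \<theta> z)) \<in> Linf" for t
    using Linf_cis[OF Linf_mult[OF const_in_Linf \<theta>]] .
  have v1: "norm (v t) = 1" for t
    unfolding v_def using f by (simp add: norm_mult_op_unimodular cisL unimodular_def)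
  have pyth: "(norm (v t - P_plus (v t)))\<^sup>2 = 1 - (norm (P_plus (v t)))\<^sup>2" for t
    using norm_P_plus_Pythagoras[of "v t"] v1[of t] by simp
  have Pv: "norm (P_plus (v t)) \<le> 1" for t using norm_P_plus_le[of "v t"] v1[of t] by simp
  have D_eq: "D t = 2 * (norm (P_plus (v t)))\<^sup>2 - 1" for t
    by (simp add: D_def power2_norm_eq_inner)
  have "arccos (D 1) \<le> 2 * ?c"
  proof (rule arccos_growth)
    fix t :: real
    have "(v has_vector_derivative A (v t)) (at t)"
      unfolding v_def A_def by (rule has_vector_derivative_mult_op_cis[OF \<theta>])
    then have "((\<lambda>t. P_plus (v t)) has_vector_derivative P_plus (A (v t))) (at t)"
      by (rule bounded_linear.has_vector_derivative[OF bounded_linear_P_plus])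
    from bounded_bilinear.has_vector_derivative[OF bounded_bilinear_inner this this]
    have "((\<lambda>t. inner (P_plus (v t)) (P_plus (v t))) has_real_derivative
        2 * inner (P_plus (v t)) (P_plus (A (v t)))) (at t)"
      by (simp add: has_real_derivative_iff_has_vector_derivative inner_commute)
    then show "(D has_real_derivative 4 * inner (P_plus (v t)) (P_plus (A (v t)))) (at t)"
      unfolding D_def by (auto intro!: derivative_eq_intros)
    show "\<bar>D t\<bar> \<le> 1"
      using power_mono[OF Pv[of t] norm_ge_zero, of 2] by (simp add: D_eq abs_le_iff)
    define h g where "h = P_plus (v t)" and "g = v t - P_plus (v t)"
    have hg: "inner g k = 0" if "k \<in> H2" for k
      unfolding g_def by (rule inner_diff_P_plus[OF that])
    have h: "h \<in> H2" by (simp add: h_def P_plus_in_H2)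
    \<comment> \<open>Orthogonality of the residual to \<open>h\<close> removes the projection;
      skew-adjointness then removes the diagonal term and moves \<open>A\<close> from
      \<open>g\<close> to \<open>h\<close>.\<close>
    have "inner h (P_plus (A (v t))) = inner h (A (v t))"
      using inner_diff_P_plus[OF h, of "A (v t)"]
      by (simp add: inner_diff_left inner_diff_right inner_commute)
    moreover have "A (v t) = A h + A g" by (simp add: h_def g_def A.diff)
    moreover have "inner h (A h) = 0"
      using inner_mult_op_imaginary[OF \<theta>, of h h] by (simp add: A_def inner_commute)
    moreover have "inner h (A g) = - inner (A h) g"
      using inner_mult_op_imaginary[OF \<theta>, of h g] by (simp add: A_def)
    ultimately have "inner h (P_plus (A (v t))) = - inner (A h) g"
      by (simp only: inner_add_right add_0_left)
    then have growth: "\<bar>4 * inner h (P_plus (A (v t)))\<bar> \<le> 4 * (?c * norm h * norm g)"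
      using inner_commutator_bound[OF \<theta> h hg] by (simp add: A_def)
    \<comment> \<open>This is the sine of the doubled angle, squared: \<open>norm h\<close> is the
      cosine and \<open>norm g\<close> the sine of the angle, as \<open>v t\<close> is a unit
      vector.\<close>
    have "1 - (D t)\<^sup>2 = (2 * (norm h * norm g))\<^sup>2"
      unfolding power_mult_distrib g_def pyth D_eq
      by (simp add: h_def power2_eq_square algebra_simps)
    then have "sqrt (1 - (D t)\<^sup>2) = 2 * (norm h * norm g)"
      by (simp only: real_sqrt_abs) simp
    with growth show "\<bar>4 * inner (P_plus (v t)) (P_plus (A (v t)))\<bar> \<le> 2 * ?c * sqrt (1 - (D t)\<^sup>2)"
      by (simp add: h_def)
  next
    have "v 0 = f" by (simp add: v_def mult_op_one)
    then show "D 0 = 1" by (simp add: D_eq P_plus_H2 f)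
    show "0 \<le> 2 * ?c"
      by (intro mult_nonneg_nonneg onorm_pos_le bounded_linear_sub
          bounded_linear_compose[OF bounded_linear_mult_op[OF Linf_of_real[OF \<theta>]]]
          bounded_linear_compose[OF bounded_linear_P_plus] bounded_linear_P_plus
          bounded_linear_mult_op[OF Linf_of_real[OF \<theta>]]) simp
  qed
  moreover have "D 1 = cos (2 * arccos (norm (P_plus (v 1))))"
    using Pv[of 1] by (simp add: D_eq cos_double_cos cos_arccos_abs)
  \<comment> \<open>The doubled angle therefore lies between 0 and \<open>pi\<close>, where
    \<open>arccos\<close> inverts \<open>cos\<close>, and the factor 2 can be cancelled.\<close>
  moreover have "arccos (norm (P_plus (v 1))) \<le> pi / 2"
    by (intro arccos_le_pi2 Pv norm_ge_zero)
  ultimately have "arccos (norm (P_plus (v 1))) \<le> ?c"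
    using arccos_lbound[of "norm (P_plus (v 1))"] Pv[of 1]
      norm_ge_zero[of "P_plus (v 1)"]
    by (simp add: arccos_cos)
  then show ?thesis by (simp add: v_def)
qed

section \<open>Passage to the infimum over unit vectors\<close>

theorem theorem3p8:
  fixes \<phi> \<psi> :: "complex \<Rightarrow> complex" and \<theta> :: "complex \<Rightarrow> real"
  assumes "\<phi> \<in> Linf" and "unimodular \<phi>"
    and "\<psi> \<in> Linf" and "unimodular \<psi>"
    and "kernel_on H2 (toeplitz (\<lambda>z. \<phi> z * cnj (\<psi> z))) = {0}"
    and "kernel_on H2 (toeplitz (\<lambda>z. cnj (\<phi> z) * \<psi> z)) = {0}"
    and "\<theta> \<in> Linf"
    and "AE z in circle_measure. exp (\<i> * complex_of_real (\<theta> z)) = \<phi> z * cnj (\<psi> z)"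
  shows "onorm (\<lambda>f. mult_op (\<lambda>z. complex_of_real (\<theta> z)) (P_plus f)
                    - P_plus (mult_op (\<lambda>z. complex_of_real (\<theta> z)) f))
           \<ge> arccos (reduced_min_modulus H2 (toeplitz (\<lambda>z. \<phi> z * cnj (\<psi> z))))"
    (is "?c \<ge> arccos ?\<gamma>")
proof -
  define T where "T = toeplitz (\<lambda>z. \<phi> z * cnj (\<psi> z))"
  define S where "S = {norm (T f) | f. f \<in> H2 \<and> norm f = 1 \<and> (\<forall>g\<in>kernel_on H2 T. cinner f g = 0)}"
  have \<gamma>: "?\<gamma> = Inf S" by (simp add: reduced_min_modulus_def S_def T_def)
  have T: "T f = P_plus (mult_op (\<lambda>z. cis (\<theta> z)) f)" for f
  proof -
    have "mult_op (\<lambda>z. \<phi> z * cnj (\<psi> z)) f = mult_op (\<lambda>z. cis (\<theta> z)) f"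
    proof (rule mult_op_cong_AE)
      show "AE z in circle_measure. \<phi> z * cnj (\<psi> z) = cis (\<theta> z)"
        using assms(8) by eventually_elim (simp add: cis_conv_exp)
    qed (use assms in \<open>simp_all add: Linf_mult Linf_cnj Linf_cis\<close>)
    then show ?thesis by (simp add: T_def toeplitz_def)
  qed
  have T_le: "norm (T f) \<le> norm f" for f
    using norm_P_plus_le[of "mult_op (\<lambda>z. cis (\<theta> z)) f"] assms(7)
    by (simp add: T norm_mult_op_unimodular Linf_cis unimodular_def)
  \<comment> \<open>The kernel is trivial, so the constant function 1 qualifies as a competitor in
    the infimum.\<close>
  have "\<forall>g\<in>kernel_on H2 T. cinner (monomial 0) g = 0"
    using assms(5) cinner_commute[of "monomial 0" 0] by (simp add: T_def)
  then have T1: "norm (T (monomial 0)) \<in> S"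
    unfolding S_def using monomial_0_in_H2 norm_monomial_0 by blast
  have S0: "0 \<le> x" if "x \<in> S" for x using that by (auto simp: S_def)
  then have "bdd_below S" by (auto simp: bdd_below_def)
  then have "Inf S \<le> norm (T (monomial 0))" by (rule cInf_lower[OF T1])
  also have "\<dots> \<le> 1" using T_le[of "monomial 0"] norm_monomial_0 by simp
  finally have Inf1: "Inf S \<le> 1" .
  have Inf0: "0 \<le> Inf S" using T1 S0 by (intro cInf_greatest) auto
  have c: "arccos x \<le> ?c" "x \<le> 1" if "x \<in> S" for x
  proof -
    from that obtain f where f: "f \<in> H2" "norm f = 1" "x = norm (T f)" by (auto simp: S_def)
    show "arccos x \<le> ?c" using arccos_norm_toeplitz_le[OF assms(7) f(1,2)] by (simp add: f(3) T)
    show "x \<le> 1" using T_le[of f] f(2,3) by simp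
  qed
  show ?thesis
  \<comment> \<open>The bounds for the elements of \<open>S\<close> are inverted by
    \<open>cos\<close>, which decreases only on [0, \<open>pi\<close>]. Beyond \<open>pi\<close> the
    claim holds because \<open>arccos\<close> never exceeds \<open>pi\<close>.\<close>
  proof (cases "?c \<le> pi")
    case True
    \<comment> \<open>In this form the bound is a common lower bound of \<open>S\<close> and passes
      to \<open>Inf S\<close>, whether or not the infimum is attained.\<close>
    have "cos ?c \<le> x" if x: "x \<in> S" for x
    proof -
      have "0 \<le> arccos x" using c(2)[OF x] S0[OF x] by (intro arccos_lbound) auto
      then have "cos ?c \<le> cos (arccos x)" using c(1)[OF x] True by (intro cos_monotone_0_pi_le)
      then show ?thesis using c(2)[OF x] S0[OF x] by simp
    qed
    then have "cos ?c \<le> Inf S" using T1 by (intro cInf_greatest) auto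
    then have "arccos (Inf S) \<le> arccos (cos ?c)"
      using Inf1 cos_ge_minus_one by (intro arccos_le_arccos) auto
    also have "0 \<le> ?c"
      using c(1)[OF T1] arccos_lbound[of "norm (T (monomial 0))"] c(2)[OF T1] S0[OF T1] by linarith
    then have "arccos (cos ?c) = ?c" using True by (intro arccos_cos)
    finally show ?thesis by (simp add: \<gamma>)
  next
    case False
    have "arccos (Inf S) \<le> pi" using Inf0 Inf1 by (intro arccos_ubound) auto
    then show ?thesis using False by (simp add: \<gamma>)
  qed
qed

end
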